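(* Let $S_0,\dots,S_k$ be finite sets and let $X=(X_j)_{j=0}^k$ be a sequence of discrete random variables with values in $S=S_0\times\dots\times S_k$, where $S_j=\mathrm{Supp}(X_j)$. Let $M=(M_j)_{j=0}^k$ be a martingale with respect to $(X_j)_{j=0}^k$, with $M_j=m_j(X_0,\dots,X_j)$ for functions $m_j:S_0\times\dots\times S_j\to\mathbb{R}$. Given constants $c=(c_j)_{j=1}^k$, let $\Gamma_M\subseteq S$ be the set of elements $(s_0,\dots,s_k)\in S$ that are stable with respect to $M$ and $c$, i.e. such that for all $1\le j\le k$ and all $s'_j\in S_j$, \[ m_j(s_0,\dots,s_{j-1},s'_j)-m_j(s_0,\dots,s_j)\le c_j. \] Then for any $t\ge0$, \[ \Pr[M_k\le M_0-t]\le\exp\!\left(\frac{-2t^2}{\sum_{j=1}^k c_j^2}\right)+\Pr[X\notin\Gamma_M]. \] *)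

theory Defs
  imports "HOL-Probability.Probability"
begin

text \<open>
  A tuple \<open>(s\<^sub>0, \<dots>, s\<^sub>j)\<close> in \<open>S\<^sub>0 \<times> \<dots> \<times> S\<^sub>j\<close> is an element of \<open>\<Pi>\<^sub>E i\<in>{..j}. S i\<close>, i.e. a function
  restricted to \<open>{..j}\<close>. The sets \<open>S\<^sub>i\<close> live in a common ambient type.
\<close>

definition prob_support :: "'w measure \<Rightarrow> ('w \<Rightarrow> 'a) \<Rightarrow> 'a set" where
  "prob_support P Y = {x. \<P>(\<omega> in P. Y \<omega> = x) > 0}"

definition history :: "(nat \<Rightarrow> 'w \<Rightarrow> 'a) \<Rightarrow> nat \<Rightarrow> 'w \<Rightarrow> nat \<Rightarrow> 'a" where
  "history X j \<omega> = (\<lambda>i\<in>{..j}. X i \<omega>)"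

text \<open>The \<open>\<sigma>\<close>-algebra generated by \<open>X\<^sub>0, \<dots>, X\<^sub>j\<close>, where \<open>X\<^sub>i\<close> takes values in the space \<open>N i\<close>.\<close>

definition natural_filtration ::
  "'w measure \<Rightarrow> (nat \<Rightarrow> 'a measure) \<Rightarrow> (nat \<Rightarrow> 'w \<Rightarrow> 'a) \<Rightarrow> nat \<Rightarrow> 'w measure" where
  "natural_filtration P N X j =
     sigma (space P) (\<Union>i\<in>{..j}. {X i -` A \<inter> space P | A. A \<in> sets (N i)})"

definition martingale_wrt ::
  "'w measure \<Rightarrow> (nat \<Rightarrow> 'a measure) \<Rightarrow> nat \<Rightarrow> (nat \<Rightarrow> 'w \<Rightarrow> 'a) \<Rightarrow> (nat \<Rightarrow> 'w \<Rightarrow> real) \<Rightarrow> bool" where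
  "martingale_wrt P N k X M \<longleftrightarrow>
     (\<forall>j\<le>k. integrable P (M j)) \<and>
     (\<forall>j\<le>k. M j \<in> borel_measurable (natural_filtration P N X j)) \<and>
     (\<forall>j<k. AE \<omega> in P. real_cond_exp P (natural_filtration P N X j) (M (Suc j)) \<omega> = M j \<omega>)"

definition stable ::
  "nat \<Rightarrow> (nat \<Rightarrow> 'a set) \<Rightarrow> (nat \<Rightarrow> (nat \<Rightarrow> 'a) \<Rightarrow> real) \<Rightarrow> (nat \<Rightarrow> real) \<Rightarrow> (nat \<Rightarrow> 'a) \<Rightarrow> bool" where
  "stable k S m c s \<longleftrightarrow>
     (\<forall>j\<in>{1..k}. \<forall>s'\<in>S j.
        m j (restrict (s(j := s')) {..j}) - m j (restrict s {..j}) \<le> c j)"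

definition stable_set ::
  "nat \<Rightarrow> (nat \<Rightarrow> 'a set) \<Rightarrow> (nat \<Rightarrow> (nat \<Rightarrow> 'a) \<Rightarrow> real) \<Rightarrow> (nat \<Rightarrow> real) \<Rightarrow> (nat \<Rightarrow> 'a) set" where
  "stable_set k S m c = {s \<in> (\<Pi>\<^sub>E i\<in>{..k}. S i). stable k S m c s}"

end

theory Submission
  imports Defs
begin

text \<open>
  Stability bounds the drop of \<open>M\<close> below the best value that was available at that step, so one
  clips: replace \<open>M\<^sub>j\<close> in the increment \<open>M\<^sub>j - M\<^sub>j\<^sub>-\<^sub>1\<close> by
  \<open>max M\<^sub>j (B - c\<^sub>j)\<close>, where \<open>B\<close> is the maximum of \<open>m\<^sub>j(X\<^sub>0, \<dots>, X\<^sub>j\<^sub>-\<^sub>1, s')\<close> over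
  \<open>s' \<in> S\<^sub>j\<close>. Clipping only increases the increments, so their conditional means are
  nonnegative; they lie in an interval of length \<open>c\<^sub>j\<close> whose position is determined by the past;
  and on \<open>\<Gamma>\<^sub>M\<close> nothing is clipped. The one-sided Azuma inequality therefore applies to the clipped
  increments, and it can be proved by applying Hoeffding's lemma on each of the finitely many
  atoms of the past. If some \<open>c\<^sub>j\<close> is negative, then \<open>\<Gamma>\<^sub>M\<close> is empty.
\<close>

section \<open>Hoeffding's lemma on an event\<close>

text \<open>This is Hoeffding's lemma for \<open>- D\<close> under the law conditioned on
  \<open>A\<close>. Hypothesis and conclusion are integrals over \<open>A\<close> not divided by
  \<open>prob A\<close>, so that atoms of probability zero are covered too.\<close>

lemma (in prob_space) Hoeffding_on_event:
  fixes D :: "'a \<Rightarrow> real"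
  assumes A [measurable]: "A \<in> events" and D [measurable]: "D \<in> borel_measurable M"
    and bounds: "\<And>\<omega>. \<omega> \<in> A \<Longrightarrow> D \<omega> \<in> {a..a + c}"
    and mean: "0 \<le> (LINT \<omega>:A|M. D \<omega>)" and l: "l > 0"
  shows "(LINT \<omega>:A|M. exp (- l * D \<omega>)) \<le> exp (l\<^sup>2 * c\<^sup>2 / 8) * prob A"
proof (cases "prob A = 0")
  case True
  then have "A \<in> null_sets M"
    by (simp add: emeasure_eq_measure null_setsI)
  then have "(LINT \<omega>:A|M. exp (- l * D \<omega>)) = 0"
    unfolding set_lebesgue_integral_def
    by (intro integral_eq_zero_AE eventually_mono[OF AE_not_in]) auto
  then show ?thesis using True by simp
next
  case False
  then have pos: "prob A > 0" by (simp add: measure_nonneg less_le)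
  define Q where "Q = uniform_measure M A"
  have sets_Q [measurable_cong]: "sets Q = sets M" and space_Q: "space Q = space M"
    by (simp_all add: Q_def)
  have eA: "emeasure M A \<noteq> 0" "emeasure M A \<noteq> \<infinity>"
    using pos by (simp_all add: emeasure_eq_measure)
  interpret Q: prob_space Q
    unfolding Q_def by (rule prob_space_uniform_measure) (use eA in auto)
  \<comment> \<open>Writing the conditional law as a density turns integrals over \<open>Q\<close>
    into integrals over \<open>A\<close> divided by \<open>prob A\<close>.\<close>
  have Q_eq: "Q = density M (\<lambda>\<omega>. indicator A \<omega> / prob A)"
    unfolding Q_def uniform_measure_def using pos
    by (intro density_cong) (auto simp: emeasure_eq_measure divide_ennreal indicator_def zero_ennreal_def[symmetric] simp flip: ennreal_1)
  have int_Q: "integral\<^sup>L Q f = (LINT \<omega>:A|M. f \<omega>) / prob A"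
    if [measurable]: "f \<in> borel_measurable M" for f :: "'a \<Rightarrow> real"
    unfolding Q_eq set_lebesgue_integral_def integral_divide_zero[symmetric]
    by (subst integral_density) auto
  have AE_A: "AE \<omega> in Q. \<omega> \<in> A"
    unfolding Q_def by (rule AE_uniform_measureI) auto
  define \<mu> where "\<mu> = integral\<^sup>L Q D"
  have \<mu>: "\<mu> \<ge> 0" using mean pos by (simp add: \<mu>_def int_Q)
  interpret neg: interval_bounded_random_variable Q "\<lambda>\<omega>. - D \<omega>" "- (a + c)" "- a"
  proof unfold_locales
    show "AE \<omega> in Q. - D \<omega> \<in> {- (a + c)..- a}"
      using AE_A by eventually_elim (use bounds in force)
  qed measurable
  have "nn_integral Q (\<lambda>\<omega>. exp (l * (- D \<omega> - - \<mu>))) \<le> ennreal (exp (l\<^sup>2 * (- a - - (a + c))\<^sup>2 / 8))"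
    using neg.Hoeffdings_lemma_nn_integral[OF l] by (simp add: \<mu>_def)
  then have "integral\<^sup>L Q (\<lambda>\<omega>. exp (l * (- D \<omega> - - \<mu>))) \<le> exp (l\<^sup>2 * c\<^sup>2 / 8)"
    by (subst integral_eq_nn_integral) (auto intro!: enn2real_leI)
  moreover have "(\<lambda>\<omega>. exp (l * (- D \<omega> - - \<mu>))) = (\<lambda>\<omega>. exp (l * \<mu>) * exp (- l * D \<omega>))"
    by (simp add: exp_add[symmetric] right_diff_distrib)
  ultimately have "exp (l * \<mu>) * integral\<^sup>L Q (\<lambda>\<omega>. exp (- l * D \<omega>)) \<le> exp (l\<^sup>2 * c\<^sup>2 / 8)"
    by simp
  moreover have "1 * integral\<^sup>L Q (\<lambda>\<omega>. exp (- l * D \<omega>)) \<le> exp (l * \<mu>) * integral\<^sup>L Q (\<lambda>\<omega>. exp (- l * D \<omega>))"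
    using l \<mu> by (intro mult_right_mono) auto
  ultimately have "integral\<^sup>L Q (\<lambda>\<omega>. exp (- l * D \<omega>)) \<le> exp (l\<^sup>2 * c\<^sup>2 / 8)"
    by simp
  then show ?thesis
    using pos by (simp add: int_Q pos_divide_le_eq)
qed

section \<open>Azuma's inequality with a finite-valued past\<close>

text \<open>The fibres of \<open>Z\<close> cut the space into finitely many disjoint pieces: the law
  of total expectation without conditional probabilities.\<close>

lemma integral_sum_fibres:
  fixes f :: "'a \<Rightarrow> real"
  assumes "finite R" and Z: "Z \<in> measurable M (count_space R)" and f: "integrable M f"
  shows "integral\<^sup>L M f = (\<Sum>z\<in>R. LINT \<omega>:(Z -` {z} \<inter> space M)|M. f \<omega>)"
proof -
  have fibre: "Z -` {z} \<inter> space M \<in> sets M" if "z \<in> R" for z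
    using measurable_sets[OF Z, of "{z}"] that by simp
  have "integral\<^sup>L M f = (\<integral>\<omega>. (\<Sum>z\<in>R. indicator (Z -` {z} \<inter> space M) \<omega> *\<^sub>R f \<omega>) \<partial>M)"
  proof (rule Bochner_Integration.integral_cong[OF refl])
    fix \<omega> assume \<omega>: "\<omega> \<in> space M"
    then have "Z \<omega> \<in> R" using measurable_space[OF Z] by auto
    have "(\<Sum>z\<in>R. indicator (Z -` {z} \<inter> space M) \<omega> *\<^sub>R f \<omega>) = (\<Sum>z\<in>R. if z = Z \<omega> then f \<omega> else 0)"
      using \<omega> by (intro sum.cong) (auto simp: indicator_def)
    also have "\<dots> = f \<omega>" using \<open>Z \<omega> \<in> R\<close> \<open>finite R\<close> by (simp add: sum.delta)
    finally show "f \<omega> = (\<Sum>z\<in>R. indicator (Z -` {z} \<inter> space M) \<omega> *\<^sub>R f \<omega>)" ..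
  qed
  also have "\<dots> = (\<Sum>z\<in>R. LINT \<omega>:(Z -` {z} \<inter> space M)|M. f \<omega>)"
    unfolding set_lebesgue_integral_def
    by (intro Bochner_Integration.integral_sum integrable_mult_indicator fibre f)
  finally show ?thesis .
qed

lemma (in finite_measure) integrable_finite_valued:
  fixes g :: "'b \<Rightarrow> real"
  assumes "finite R" and Z: "Z \<in> measurable M (count_space R)"
  shows "integrable M (\<lambda>\<omega>. g (Z \<omega>))"
proof (rule integrable_const_bound[where B = "\<Sum>z\<in>R. \<bar>g z\<bar>"])
  show "AE \<omega> in M. norm (g (Z \<omega>)) \<le> (\<Sum>z\<in>R. \<bar>g z\<bar>)"
    using measurable_space[OF Z] \<open>finite R\<close> by (auto intro!: member_le_sum)
  show "(\<lambda>\<omega>. g (Z \<omega>)) \<in> borel_measurable M"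
    using Z by (rule measurable_compose) simp
qed

text \<open>On a fibre of \<open>Z\<close> the weight \<open>g (Z \<omega>)\<close> and the interval
  containing \<open>D\<close> are fixed, so Hoeffding's lemma applies fibre by fibre and the bounds
  add up. The weight is meant to carry the exponential of the earlier increments.\<close>

lemma (in prob_space) Hoeffding_conditional_step:
  fixes D :: "'a \<Rightarrow> real" and a g :: "'b \<Rightarrow> real"
  assumes R: "finite R" and Z: "Z \<in> measurable M (count_space R)"
    and D [measurable]: "D \<in> borel_measurable M"
    and bounds: "\<And>\<omega>. \<omega> \<in> space M \<Longrightarrow> D \<omega> \<in> {a (Z \<omega>)..a (Z \<omega>) + c}"
    and mean: "\<And>z. z \<in> R \<Longrightarrow> 0 \<le> (LINT \<omega>:(Z -` {z} \<inter> space M)|M. D \<omega>)"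
    and g: "\<And>z. g z \<ge> 0" and l: "l > 0"
  shows "expectation (\<lambda>\<omega>. g (Z \<omega>) * exp (- l * D \<omega>))
    \<le> exp (l\<^sup>2 * c\<^sup>2 / 8) * expectation (\<lambda>\<omega>. g (Z \<omega>))"
proof -
  have gZ [measurable]: "(\<lambda>\<omega>. g (Z \<omega>)) \<in> borel_measurable M"
    using Z by (rule measurable_compose) simp
  have fibre: "Z -` {z} \<inter> space M \<in> sets M" if "z \<in> R" for z
    using measurable_sets[OF Z, of "{z}"] that by simp
  \<comment> \<open>Since \<open>D \<omega> \<ge> a (Z \<omega>)\<close>, the integrand is dominated
    by a function of \<open>Z\<close>, which takes finitely many values.\<close>
  have integrable: "integrable M (\<lambda>\<omega>. g (Z \<omega>) * exp (- l * D \<omega>))"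
  proof (rule Bochner_Integration.integrable_bound)
    show "integrable M (\<lambda>\<omega>. (\<lambda>z. g z * exp (- l * a z)) (Z \<omega>))"
      using R Z by (rule integrable_finite_valued)
    show "AE \<omega> in M. norm (g (Z \<omega>) * exp (- l * D \<omega>)) \<le> norm (g (Z \<omega>) * exp (- l * a (Z \<omega>)))"
      using g l bounds by (auto simp: abs_mult intro!: mult_left_mono)
  qed simp
  have *: "(LINT \<omega>:(Z -` {z} \<inter> space M)|M. g (Z \<omega>) * f \<omega>)
      = g z * (LINT \<omega>:(Z -` {z} \<inter> space M)|M. f \<omega>)" for z and f :: "'a \<Rightarrow> real"
    unfolding set_lebesgue_integral_def integral_mult_right_zero[symmetric]
    by (rule Bochner_Integration.integral_cong) (auto simp: indicator_def)
  have "expectation (\<lambda>\<omega>. g (Z \<omega>) * exp (- l * D \<omega>))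
      = (\<Sum>z\<in>R. g z * (LINT \<omega>:(Z -` {z} \<inter> space M)|M. exp (- l * D \<omega>)))"
    by (subst integral_sum_fibres[OF R Z integrable]) (simp only: *)
  also have "\<dots> \<le> (\<Sum>z\<in>R. g z * (exp (l\<^sup>2 * c\<^sup>2 / 8) * prob (Z -` {z} \<inter> space M)))"
  proof (intro sum_mono mult_left_mono g)
    fix z assume z: "z \<in> R"
    show "(LINT \<omega>:(Z -` {z} \<inter> space M)|M. exp (- l * D \<omega>))
        \<le> exp (l\<^sup>2 * c\<^sup>2 / 8) * prob (Z -` {z} \<inter> space M)"
      by (rule Hoeffding_on_event[where a = "a z"]) (use bounds fibre[OF z] mean[OF z] l in auto)
  qed
  \<comment> \<open>Fibre probabilities become integrals of 1, so that \<open>*\<close> and the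
    fibre decomposition reassemble the expectation of the weight.\<close>
  also have "\<dots> = exp (l\<^sup>2 * c\<^sup>2 / 8) * (\<Sum>z\<in>R. g z * (LINT \<omega>:(Z -` {z} \<inter> space M)|M. 1))"
    by (simp add: sum_distrib_left mult.left_commute set_lebesgue_integral_def fibre)
  also have "(\<Sum>z\<in>R. g z * (LINT \<omega>:(Z -` {z} \<inter> space M)|M. 1)) = expectation (\<lambda>\<omega>. g (Z \<omega>))"
    using *[of _ "\<lambda>_. 1"]
    by (simp add: integral_sum_fibres[OF R Z integrable_finite_valued[OF R Z]])
  finally show ?thesis .
qed

text \<open>\<open>Z j\<close> is the past before the increment \<open>D j\<close>; it is assumed finite-valued.\<close>

lemma (in prob_space) Azuma_exp_moment:
  fixes D :: "nat \<Rightarrow> 'a \<Rightarrow> real" and Z :: "nat \<Rightarrow> 'a \<Rightarrow> 'b"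
  assumes R: "\<And>j. j < n \<Longrightarrow> finite (R j)"
    and Z: "\<And>j. j < n \<Longrightarrow> Z j \<in> measurable M (count_space (R j))"
    and D: "\<And>j. j < n \<Longrightarrow> D j \<in> borel_measurable M"
    and adapted: "\<And>j \<omega>. j < n \<Longrightarrow> \<omega> \<in> space M \<Longrightarrow> (\<Sum>i<j. D i \<omega>) = Y j (Z j \<omega>)"
    and bounds: "\<And>j \<omega>. j < n \<Longrightarrow> \<omega> \<in> space M \<Longrightarrow> D j \<omega> \<in> {a j (Z j \<omega>)..a j (Z j \<omega>) + c j}"
    and mean: "\<And>j z. j < n \<Longrightarrow> z \<in> R j \<Longrightarrow> 0 \<le> (LINT \<omega>:(Z j -` {z} \<inter> space M)|M. D j \<omega>)"
    and l: "l > 0"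
  shows "expectation (\<lambda>\<omega>. exp (- l * (\<Sum>j<n. D j \<omega>))) \<le> exp (l\<^sup>2 * (\<Sum>j<n. (c j)\<^sup>2) / 8)"
  using assms(1-6)
proof (induction n)
  case 0
  then show ?case by (simp add: prob_space)
next
  case (Suc n)
  \<comment> \<open>By \<open>adapted\<close> the first \<open>n\<close> increments sum to a
    function of \<open>Z n\<close>, so their exponential can serve as the weight for the last
    increment.\<close>
  let ?g = "\<lambda>z. exp (- l * Y n z)"
  have "expectation (\<lambda>\<omega>. exp (- l * (\<Sum>j<Suc n. D j \<omega>)))
      = expectation (\<lambda>\<omega>. ?g (Z n \<omega>) * exp (- l * D n \<omega>))"
    using Suc.prems(4) by (intro Bochner_Integration.integral_cong)
      (auto simp: algebra_simps simp flip: exp_add)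
  also have "\<dots> \<le> exp (l\<^sup>2 * (c n)\<^sup>2 / 8) * expectation (\<lambda>\<omega>. ?g (Z n \<omega>))"
    using Suc.prems l by (intro Hoeffding_conditional_step[where R = "R n" and a = "a n"]) auto
  also have "expectation (\<lambda>\<omega>. ?g (Z n \<omega>)) = expectation (\<lambda>\<omega>. exp (- l * (\<Sum>j<n. D j \<omega>)))"
    using Suc.prems(4) by (intro Bochner_Integration.integral_cong) auto
  also have "\<dots> \<le> exp (l\<^sup>2 * (\<Sum>j<n. (c j)\<^sup>2) / 8)"
    using Suc.prems by (intro Suc.IH) auto
  finally show ?case
    by (simp add: algebra_simps add_divide_distrib exp_add)
qed

text \<open>Chernoff's method: Markov's inequality for
  \<open>exp (- l * (\<Sum>j<n. D j \<omega>))\<close>, then the moment bound, with \<open>l\<close>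
  chosen optimally.\<close>

theorem (in prob_space) Azuma_lower_tail:
  fixes D :: "nat \<Rightarrow> 'a \<Rightarrow> real" and Z :: "nat \<Rightarrow> 'a \<Rightarrow> 'b"
  assumes R: "\<And>j. j < n \<Longrightarrow> finite (R j)"
    and Z: "\<And>j. j < n \<Longrightarrow> Z j \<in> measurable M (count_space (R j))"
    and D: "\<And>j. j < n \<Longrightarrow> D j \<in> borel_measurable M"
    and adapted: "\<And>j \<omega>. j < n \<Longrightarrow> \<omega> \<in> space M \<Longrightarrow> (\<Sum>i<j. D i \<omega>) = Y j (Z j \<omega>)"
    and bounds: "\<And>j \<omega>. j < n \<Longrightarrow> \<omega> \<in> space M \<Longrightarrow> D j \<omega> \<in> {a j (Z j \<omega>)..a j (Z j \<omega>) + c j}"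
    and mean: "\<And>j z. j < n \<Longrightarrow> z \<in> R j \<Longrightarrow> 0 \<le> (LINT \<omega>:(Z j -` {z} \<inter> space M)|M. D j \<omega>)"
    and t: "t \<ge> 0"
  shows "\<P>(\<omega> in M. (\<Sum>j<n. D j \<omega>) \<le> - t) \<le> exp (- 2 * t\<^sup>2 / (\<Sum>j<n. (c j)\<^sup>2))"
\<comment> \<open>In the degenerate case the right-hand side is \<open>exp 0 = 1\<close>; for a
  vanishing sum this is because division by zero gives 0.\<close>
proof (cases "t = 0 \<or> (\<Sum>j<n. (c j)\<^sup>2) = 0")
  case True
  then show ?thesis by auto
next
  case False
  define C where "C = (\<Sum>j<n. (c j)\<^sup>2)"
  have C: "C > 0" using False by (simp add: C_def less_le sum_nonneg)
  \<comment> \<open>This value minimises the exponent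
    \<open>l\<^sup>2 * C / 8 - l * t\<close>.\<close>
  define l where "l = 4 * t / C"
  have l: "l > 0" using False t C by (simp add: l_def)
  have D_sum [measurable]: "(\<lambda>\<omega>. \<Sum>j<n. D j \<omega>) \<in> borel_measurable M"
    using D by (intro borel_measurable_sum) auto
  let ?E = "\<lambda>\<omega>. exp (- l * (\<Sum>j<n. D j \<omega>))"
  \<comment> \<open>A deterministic lower bound for the sum bounds \<open>?E\<close> from above,
    which gives the integrability that Markov's inequality requires.\<close>
  have lower: "(\<Sum>j<n. - (\<Sum>z\<in>R j. \<bar>a j z\<bar>)) \<le> (\<Sum>j<n. D j \<omega>)" if \<omega>: "\<omega> \<in> space M" for \<omega>
  proof (rule sum_mono)
    fix j assume "j \<in> {..<n}"
    then have j: "j < n" by simp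
    have "Z j \<omega> \<in> R j" using measurable_space[OF Z[OF j] \<omega>] by simp
    then have "\<bar>a j (Z j \<omega>)\<bar> \<le> (\<Sum>z\<in>R j. \<bar>a j z\<bar>)"
      using R[OF j] by (intro member_le_sum) auto
    then show "- (\<Sum>z\<in>R j. \<bar>a j z\<bar>) \<le> D j \<omega>" using abs_le_D2 bounds[OF j \<omega>] by fastforce
  qed
  have integrable: "integrable M ?E"
    by (rule integrable_const_bound[where B = "exp (- l * (\<Sum>j<n. - (\<Sum>z\<in>R j. \<bar>a j z\<bar>)))"])
       (use lower l in \<open>auto intro!: AE_I2 mult_left_mono\<close>)
  have "exp (l * t) \<le> ?E \<omega> \<longleftrightarrow> (\<Sum>j<n. D j \<omega>) \<le> - t" for \<omega>
    using mult_le_cancel_left_pos[OF l, of t "- (\<Sum>j<n. D j \<omega>)"] by (auto simp: le_minus_iff)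
  then have "\<P>(\<omega> in M. (\<Sum>j<n. D j \<omega>) \<le> - t) = \<P>(\<omega> in M. ?E \<omega> \<ge> exp (l * t))"
    by (simp only:)
  also have "\<dots> \<le> expectation ?E / exp (l * t)"
    by (rule integral_Markov_inequality_measure[where A = "{}"]) (use integrable in auto)
  also have "\<dots> \<le> exp (l\<^sup>2 * C / 8) / exp (l * t)"
    using Azuma_exp_moment[OF R Z D adapted bounds mean l]
    by (intro divide_right_mono) (auto simp: C_def)
  also have "\<dots> = exp (l\<^sup>2 * C / 8 - l * t)"
    by (simp add: exp_diff)
  also have "l\<^sup>2 * C / 8 - l * t = - 2 * t\<^sup>2 / C"
    using C by (simp add: l_def power2_eq_square field_simps)
  finally show ?thesis by (simp add: C_def)
qed

section \<open>Histories and the natural filtration\<close>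

text \<open>The target is finite, and the fibre over a tuple is a finite intersection of coordinate
  fibres. The space \<open>F\<close> is arbitrary because the result serves both for
  \<open>P\<close> and for the natural filtration.\<close>

lemma measurable_history:
  assumes S: "\<And>i. i \<le> j \<Longrightarrow> finite (S i)"
    and X: "\<And>i. i \<le> j \<Longrightarrow> X i \<in> measurable F (count_space (S i))"
  shows "history X j \<in> measurable F (count_space (\<Pi>\<^sub>E i\<in>{..j}. S i))"
proof -
  have fin: "finite (\<Pi>\<^sub>E i\<in>{..j}. S i)" using S by (intro finite_PiE) auto
  have "history X j \<omega> \<in> (\<Pi>\<^sub>E i\<in>{..j}. S i)" if "\<omega> \<in> space F" for \<omega>
    using measurable_space[OF X that] by (auto simp: history_def)
  moreover have "history X j -` {h} \<inter> space F \<in> sets F" if h: "h \<in> (\<Pi>\<^sub>E i\<in>{..j}. S i)" for h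
  proof -
    have "history X j -` {h} \<inter> space F = (\<Inter>i\<in>{..j}. X i -` {h i} \<inter> space F)"
    proof (intro equalityI subsetI)
      fix \<omega> assume \<omega>: "\<omega> \<in> (\<Inter>i\<in>{..j}. X i -` {h i} \<inter> space F)"
      then have "history X j \<omega> = h"
        using h by (auto simp: history_def fun_eq_iff restrict_def PiE_def extensional_def)
      then show "\<omega> \<in> history X j -` {h} \<inter> space F" using \<omega> by auto
    qed (auto simp: history_def)
    moreover have fibre: "X i -` {h i} \<inter> space F \<in> sets F" if "i \<le> j" for i
      using measurable_sets[OF X[OF that], of "{h i}"] h that by auto
    moreover have "(\<Inter>i\<in>{..j}. X i -` {h i} \<inter> space F) \<in> sets F"
      by (rule sets.finite_INT) (use fibre in auto)
    ultimately show ?thesis by simp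
  qed
  ultimately show ?thesis using fin by (auto simp: measurable_count_space_eq2)
qed

lemma measurable_natural_filtration:
  assumes "i \<le> j" and "X i \<in> measurable P (N i)"
  shows "X i \<in> measurable (natural_filtration P N X j) (N i)"
proof (rule measurableI)
  fix \<omega> assume "\<omega> \<in> space (natural_filtration P N X j)"
  then show "X i \<omega> \<in> space (N i)"
    using measurable_space[OF assms(2)] by (simp add: natural_filtration_def space_measure_of_conv)
next
  fix A assume A: "A \<in> sets (N i)"
  have "X i -` A \<inter> space P \<in> sets (natural_filtration P N X j)"
    unfolding natural_filtration_def
    by (subst sets_measure_of) (use A assms(1) in auto)
  then show "X i -` A \<inter> space (natural_filtration P N X j) \<in> sets (natural_filtration P N X j)"
    by (simp add: natural_filtration_def space_measure_of_conv)
qed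

lemma subalgebra_natural_filtration:
  assumes "\<And>i. i \<le> j \<Longrightarrow> X i \<in> measurable P (N i)"
  shows "subalgebra P (natural_filtration P N X j)"
proof -
  let ?G = "\<Union>i\<in>{..j}. {X i -` A \<inter> space P | A. A \<in> sets (N i)}"
  have G: "?G \<subseteq> sets P" using measurable_sets[OF assms] by auto
  then have "?G \<subseteq> Pow (space P)" using sets.space_closed by (rule subset_trans)
  then have "sets (natural_filtration P N X j) = sigma_sets (space P) ?G"
    unfolding natural_filtration_def by (rule sets_measure_of)
  with G show ?thesis
    by (simp add: subalgebra_def natural_filtration_def space_measure_of_conv sets.sigma_sets_subset)
qed

text \<open>The form in which the martingale property is used: conditional expectation preserves
  integrals over events of the past, in particular over its atoms.\<close>

lemma martingale_wrt_set_integral: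
  assumes P: "prob_space P" and X: "\<And>i. i \<le> k \<Longrightarrow> X i \<in> measurable P (N i)"
    and M: "martingale_wrt P N k X M" and j: "j < k"
    and A: "A \<in> sets (natural_filtration P N X j)"
  shows "(LINT \<omega>:A|P. M (Suc j) \<omega>) = (LINT \<omega>:A|P. M j \<omega>)"
proof -
  let ?F = "natural_filtration P N X j"
  interpret prob_space P by (rule P)
  have sub: "subalgebra P ?F" using X j by (intro subalgebra_natural_filtration) auto
  interpret finite_measure_subalgebra P ?F by unfold_locales (rule sub)
  have [measurable]: "A \<in> sets P" using sub A by (auto simp: subalgebra_def)
  have int: "integrable P (M (Suc j))" and "integrable P (M j)"
    using M j by (auto simp: martingale_wrt_def)
  then have [measurable]: "M j \<in> borel_measurable P" by simp
  have "(LINT \<omega>:A|P. M (Suc j) \<omega>) = (LINT \<omega>:A|P. real_cond_exp P ?F (M (Suc j)) \<omega>)"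
    by (rule real_cond_exp_intA) (use int A in auto)
  also have "\<dots> = (LINT \<omega>:A|P. M j \<omega>)"
    using M j by (intro set_lebesgue_integral_cong_AE) (auto simp: martingale_wrt_def)
  finally show ?thesis .
qed

lemma restrict_history: "i \<le> j \<Longrightarrow> restrict (history X j \<omega>) {..i} = history X i \<omega>"
  by (auto simp: history_def fun_eq_iff)

text \<open>This reconciles the tuple in \<open>stable\<close>, cut out of the full history, with
  the one obtained by appending a candidate value to the past.\<close>

lemma restrict_history_upd:
  "Suc j \<le> k \<Longrightarrow> restrict ((history X k \<omega>)(Suc j := s)) {..Suc j} = (history X j \<omega>)(Suc j := s)"
  by (auto simp: history_def fun_eq_iff)

section \<open>Clipped increments and the stable set\<close>

theorem theorem3p2:
  fixes P :: "'w measure" and k :: nat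
    and S :: "nat \<Rightarrow> 'a set" and X :: "nat \<Rightarrow> 'w \<Rightarrow> 'a"
    and M :: "nat \<Rightarrow> 'w \<Rightarrow> real" and m :: "nat \<Rightarrow> (nat \<Rightarrow> 'a) \<Rightarrow> real"
    and c :: "nat \<Rightarrow> real" and t :: real
  assumes "prob_space P"
    and "\<And>j. j \<le> k \<Longrightarrow> finite (S j)"
    and "\<And>j. j \<le> k \<Longrightarrow> X j \<in> measurable P (count_space (S j))"
    and "\<And>j. j \<le> k \<Longrightarrow> S j = prob_support P (X j)"
    and "martingale_wrt P (\<lambda>j. count_space (S j)) k X M"
    and "\<And>j \<omega>. j \<le> k \<Longrightarrow> \<omega> \<in> space P \<Longrightarrow> M j \<omega> = m j (history X j \<omega>)"
    and "t \<ge> 0"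
  shows "\<P>(\<omega> in P. M k \<omega> \<le> M 0 \<omega> - t)
           \<le> exp (- 2 * t\<^sup>2 / (\<Sum>j=1..k. (c j)\<^sup>2))
             + \<P>(\<omega> in P. history X k \<omega> \<notin> stable_set k S m c)"
proof (cases "\<forall>j\<in>{1..k}. c j \<ge> 0")
  case False
  then obtain j where j: "j \<in> {1..k}" "c j < 0" by (auto simp: not_le)
  interpret prob_space P by fact
  have "history X k \<omega> \<notin> stable_set k S m c" if \<omega>: "\<omega> \<in> space P" for \<omega>
  proof
    assume "history X k \<omega> \<in> stable_set k S m c"
    then have "\<forall>s'\<in>S j. m j (restrict ((history X k \<omega>)(j := s')) {..j})
        - m j (restrict (history X k \<omega>) {..j}) \<le> c j"
      using j by (simp add: stable_set_def stable_def)
    \<comment> \<open>Choosing \<open>s' = X j \<omega>\<close> makes the difference zero, so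
      stability would force \<open>0 \<le> c j\<close>.\<close>
    moreover have "X j \<omega> \<in> S j" using measurable_space[OF assms(3) \<omega>] j by simp
    moreover have "(history X k \<omega>)(j := X j \<omega>) = history X k \<omega>"
      using j by (auto simp: history_def)
    ultimately show False using j by force
  qed
  then have "{\<omega> \<in> space P. history X k \<omega> \<notin> stable_set k S m c} = space P" by auto
  then have "\<P>(\<omega> in P. history X k \<omega> \<notin> stable_set k S m c) = 1" by (simp add: prob_space)
  then show ?thesis by (simp add: add_increasing)
next
  case True
  then have c: "c (Suc j) \<ge> 0" if "j < k" for j using that by auto
  interpret prob_space P by fact
  note S = assms(2) and X = assms(3) and mart = assms(5) and M_eq = assms(6)
  define R where "R j = (\<Pi>\<^sub>E i\<in>{..j}. S i)" for j
  have R: "finite (R j)" if "j \<le> k" for j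
    unfolding R_def using S that by (intro finite_PiE) auto
  have hist: "history X j \<in> measurable P (count_space (R j))" if "j \<le> k" for j
    unfolding R_def using S X that by (intro measurable_history) auto
  have M_int: "integrable P (M j)" if "j \<le> k" for j
    using mart that by (simp add: martingale_wrt_def)
  define B where "B j h = Max ((\<lambda>s. m (Suc j) (h(Suc j := s))) ` S (Suc j))" for j h
  \<comment> \<open>\<open>d j\<close> computes the clipped increment from any history reaching at
    least index \<open>Suc j\<close>. For \<open>i < j\<close> this holds of the history up to
    \<open>j\<close>, so the earlier increments are functions of the past.\<close>
  define d where "d j h = max (m (Suc j) (restrict h {..Suc j})) (B j (restrict h {..j}) - c (Suc j))
      - m j (restrict h {..j})" for j h
  \<comment> \<open>\<open>D j\<close> is the clipped step from time \<open>j\<close> to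
    \<open>Suc j\<close>, hence the bound \<open>c (Suc j)\<close> and the sums over
    \<open>j < k\<close>.\<close>
  define D where "D j \<omega> = max (M (Suc j) \<omega>) (B j (history X j \<omega>) - c (Suc j)) - M j \<omega>" for j \<omega>
  have hist_Suc: "(history X j \<omega>)(Suc j := X (Suc j) \<omega>) = history X (Suc j) \<omega>" for j \<omega>
    by (auto simp: history_def fun_eq_iff)
  have M_le_B: "M (Suc j) \<omega> \<le> B j (history X j \<omega>)" if "j < k" "\<omega> \<in> space P" for j \<omega>
  proof -
    have "X (Suc j) \<omega> \<in> S (Suc j)" using measurable_space[OF X that(2), of "Suc j"] that by simp
    then show ?thesis
      unfolding B_def using S[of "Suc j"] that
      by (intro Max_ge) (auto simp: M_eq simp flip: hist_Suc)
  qed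
  have D_int: "integrable P (D j)" if "j < k" for j
    unfolding D_def using that
    by (intro Bochner_Integration.integrable_diff integrable_max M_int
        integrable_finite_valued[OF R hist] integrable_const) auto
  have tail: "\<P>(\<omega> in P. (\<Sum>j<k. D j \<omega>) \<le> - t) \<le> exp (- 2 * t\<^sup>2 / (\<Sum>j<k. (c (Suc j))\<^sup>2))"
  proof (rule Azuma_lower_tail)
    fix j assume j: "j < k"
    show "finite (R j)" "history X j \<in> measurable P (count_space (R j))"
      using R hist j by auto
    show "D j \<in> borel_measurable P" using D_int[OF j] by simp
    show "(\<Sum>i<j. D i \<omega>) = (\<lambda>h. \<Sum>i<j. d i h) (history X j \<omega>)" if "\<omega> \<in> space P" for \<omega>
      using that j by (auto simp: D_def d_def restrict_history M_eq intro!: sum.cong)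
    show "D j \<omega> \<in> {(B j (history X j \<omega>) - c (Suc j) - m j (history X j \<omega>))..
        (B j (history X j \<omega>) - c (Suc j) - m j (history X j \<omega>)) + c (Suc j)}"
      if "\<omega> \<in> space P" for \<omega>
      \<comment> \<open>The lower end comes from the clipping. The upper end is
        \<open>B - m j\<close>: both arguments of the maximum are at most \<open>B\<close>, the
        second one because \<open>c (Suc j) \<ge> 0\<close>.\<close>
      using M_le_B[OF j that] c[OF j] M_eq[of j \<omega>] j that by (auto simp: D_def)
    fix h assume h: "h \<in> R j"
    let ?A = "history X j -` {h} \<inter> space P" and ?F = "natural_filtration P (\<lambda>j. count_space (S j)) X j"
    \<comment> \<open>The history is measurable for its own filtration, so the atom
      \<open>?A\<close> is an event to which the martingale property applies.\<close>
    have "history X j \<in> measurable ?F (count_space (R j))"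
      unfolding R_def using S X j
      by (intro measurable_history measurable_natural_filtration) auto
    from measurable_sets[OF this, of "{h}"] h have A: "?A \<in> sets ?F"
      by (simp add: natural_filtration_def space_measure_of_conv)
    have A': "?A \<in> sets P" using measurable_sets[OF hist, of j "{h}"] j h by simp
    have set_int: "set_integrable P ?A f" if "integrable P f" for f :: "'w \<Rightarrow> real"
      using A' that by (simp add: set_integrable_def integrable_mult_indicator
          del: real_scaleR_def)
    have "0 = (LINT \<omega>:?A|P. M (Suc j) \<omega> - M j \<omega>)"
      using martingale_wrt_set_integral[OF assms(1) X mart j A] j
      by (subst set_integral_diff) (auto intro!: set_int M_int)
    \<comment> \<open>Clipping only raises the increment, so its integral over the atom stays
      nonnegative.\<close>
    also have "\<dots> \<le> (LINT \<omega>:?A|P. D j \<omega>)"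
      using j by (intro set_integral_mono set_int D_int Bochner_Integration.integrable_diff M_int)
        (auto simp: D_def)
    finally show "0 \<le> (LINT \<omega>:?A|P. D j \<omega>)" .
  qed (rule assms(7))
  have no_clip: "(\<Sum>j<k. D j \<omega>) = M k \<omega> - M 0 \<omega>"
    if \<omega>: "\<omega> \<in> space P" and st: "history X k \<omega> \<in> stable_set k S m c" for \<omega>
  proof -
    have "D j \<omega> = M (Suc j) \<omega> - M j \<omega>" if j: "j < k" for j
    proof -
      have "m (Suc j) ((history X j \<omega>)(Suc j := s)) \<le> M (Suc j) \<omega> + c (Suc j)" if "s \<in> S (Suc j)" for s
      proof -
        have "m (Suc j) (restrict ((history X k \<omega>)(Suc j := s)) {..Suc j})
            - m (Suc j) (restrict (history X k \<omega>) {..Suc j}) \<le> c (Suc j)"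
          using st j that by (simp add: stable_set_def stable_def)
        then show ?thesis
          using j \<omega> by (simp add: restrict_history restrict_history_upd M_eq)
      qed
      \<comment> \<open>With a nonempty set of candidates, their common bound passes to the maximum,
        so \<open>B - c\<close> does not exceed \<open>M (Suc j)\<close> and the clipping is
        inactive.\<close>
      moreover have "S (Suc j) \<noteq> {}" using measurable_space[OF X \<omega>, of "Suc j"] j by auto
      ultimately have "B j (history X j \<omega>) \<le> M (Suc j) \<omega> + c (Suc j)"
        unfolding B_def using S[of "Suc j"] j by (intro Max.boundedI) auto
      then show ?thesis by (simp add: D_def)
    qed
    then show ?thesis by (simp add: sum_lessThan_telescope[where f = "\<lambda>j. M j \<omega>"])
  qed
  let ?T = "{\<omega> \<in> space P. (\<Sum>j<k. D j \<omega>) \<le> - t}"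
  let ?U = "{\<omega> \<in> space P. history X k \<omega> \<notin> stable_set k S m c}"
  have D_meas: "(\<lambda>\<omega>. \<Sum>j<k. D j \<omega>) \<in> borel_measurable P"
    using D_int by (intro borel_measurable_sum) auto
  have T: "?T \<in> sets P" using D_meas by measurable
  have "?U = history X k -` (R k - stable_set k S m c) \<inter> space P"
    using measurable_space[OF hist[OF order.refl]] by auto
  then have U: "?U \<in> sets P"
    using measurable_sets[OF hist[OF order.refl], of "R k - stable_set k S m c"] by simp
  \<comment> \<open>Outside \<open>?U\<close> the clipped increments telescope to
    \<open>M k \<omega> - M 0 \<omega>\<close>, so a large drop lies in \<open>?T\<close>.\<close>
  have "\<P>(\<omega> in P. M k \<omega> \<le> M 0 \<omega> - t) \<le> prob (?T \<union> ?U)"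
    using T U by (intro finite_measure_mono) (auto simp: no_clip)
  also have "\<dots> \<le> prob ?T + prob ?U"
    by (rule measure_Un_le[OF T U])
  also have "prob ?T \<le> exp (- 2 * t\<^sup>2 / (\<Sum>j=1..k. (c j)\<^sup>2))"
    using tail by (simp add: sum.atLeast1_atMost_eq)
  finally show ?thesis by simp
qed

end
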